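(* Fix an integer $r\ge3$. Then $\tilde M_{r,1,\infty}$ and $\tilde B_{r,1,\infty}$ are subgroups of $\mathrm{Aut}(T_\infty)$. Moreover, $R_{r,1}:\tilde M_{r,1,\infty}\to\mathbb{Z}/2\mathbb{Z}$ is a homomorphism with kernel $\tilde B_{r,1,\infty}$.
   Context: $T_\infty$ is the infinite binary rooted tree whose nodes are finite words in $\{a,b\}$ ($w$ joined to $wa,wb$), with automorphism group $\mathrm{Aut}(T_\infty)$. For $\sigma\in\mathrm{Aut}(T_\infty)$ and a word $x$, $\mathrm{Par}(\sigma,x)\in\mathbb{Z}/2\mathbb{Z}$ is $0$ if $\sigma(xa)=\sigma(x)a$ and $1$ if $\sigma(xa)=\sigma(x)b$. $P^a_{r,1}(\sigma,x)=\mathrm{Par}(\sigma,xb)+\sum_{w\in\{a,b\}^{r-1}}\mathrm{Par}(\sigma,xaw)$, $P^b_{r,1}(\sigma,x)=\mathrm{Par}(\sigma,xa)+\sum_{w\in\{a,b\}^{r-1}}\mathrm{Par}(\sigma,xbw)$ (mod 2); $M_{r,1,\infty}$ is the set of $\sigma$ for which all these values over all nodes coincide (common value $P_{r,1}(\sigma)$), and $B_{r,1,\infty}=\{\sigma\in M_{r,1,\infty}:P_{r,1}(\sigma)=0\}$. $R_{r,1}(\sigma,x)=\mathrm{Par}(\sigma,xa)\mathrm{Par}(\sigma,xb)+\sum_{w\in\{a,b\}^{r-2}}(\mathrm{Par}(\sigma,xabw)+\mathrm{Par}(\sigma,xbbw))\in\mathbb{Z}/2\mathbb{Z}$. $\tilde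 M_{r,1,\infty}$ is the set of $\sigma\in B_{r,1,\infty}$ with $R_{r,1}(\sigma,x_1)=R_{r,1}(\sigma,x_2)$ for all nodes $x_1,x_2$; $R_{r,1}(\sigma)$ is the common value; $\tilde B_{r,1,\infty}=\{\sigma\in\tilde M_{r,1,\infty}:R_{r,1}(\sigma)=0\}$. *)

theory Defs
  imports "HOL-Algebra.Coset" "HOL-Library.Z2"
begin

datatype letter = LA | LB

text \<open>Nodes of the tree are finite words; the word \<open>wa\<close> is \<open>w @ [LA]\<close>. The root is \<open>[]\<close>.\<close>

type_synonym node = "letter list"

definition tree_adj :: "node \<Rightarrow> node \<Rightarrow> bool" where
  "tree_adj x y \<longleftrightarrow> (\<exists>c. y = x @ [c] \<or> x = y @ [c])"

definition tree_automorphism :: "(node \<Rightarrow> node) \<Rightarrow> bool" where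
  "tree_automorphism s \<longleftrightarrow>
     bij s \<and> s [] = [] \<and> (\<forall>x y. tree_adj (s x) (s y) \<longleftrightarrow> tree_adj x y)"

definition Aut_tree :: "(node \<Rightarrow> node) monoid" where
  "Aut_tree = \<lparr>carrier = {s. tree_automorphism s}, mult = (\<circ>), one = id\<rparr>"

text \<open>The additive group of the two-element field, i.e. Z/2Z.\<close>

definition Z2_add :: "bit monoid" where
  "Z2_add = \<lparr>carrier = UNIV, mult = (+), one = 0\<rparr>"

text \<open>For an automorphism, \<open>s (xa)\<close> is either \<open>s(x)a\<close> or \<open>s(x)b\<close> (see \<open>tree_automorphism_child\<close>
  below), so the \<open>else\<close> branch is exactly the case \<open>s (xa) = s(x)b\<close>.\<close>

definition Par :: "(node \<Rightarrow> node) \<Rightarrow> node \<Rightarrow> bit" where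
  "Par s x = (if s (x @ [LA]) = s x @ [LA] then 0 else 1)"

definition words :: "nat \<Rightarrow> node set" where
  "words n = {w. length w = n}"

definition P_a :: "nat \<Rightarrow> (node \<Rightarrow> node) \<Rightarrow> node \<Rightarrow> bit" where
  "P_a r s x = Par s (x @ [LB]) + (\<Sum>w\<in>words (r - 1). Par s (x @ [LA] @ w))"

definition P_b :: "nat \<Rightarrow> (node \<Rightarrow> node) \<Rightarrow> node \<Rightarrow> bit" where
  "P_b r s x = Par s (x @ [LA]) + (\<Sum>w\<in>words (r - 1). Par s (x @ [LB] @ w))"

definition M_set :: "nat \<Rightarrow> (node \<Rightarrow> node) set" where
  "M_set r = {s \<in> carrier Aut_tree. \<exists>c. \<forall>x. P_a r s x = c \<and> P_b r s x = c}"

text \<open>Meaningful only on \<open>M_set r\<close>, where the common value exists; likewise \<open>R_val\<close> below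
  is meaningful only on \<open>Mt_set r\<close>.\<close>

definition P_val :: "nat \<Rightarrow> (node \<Rightarrow> node) \<Rightarrow> bit" where
  "P_val r s = (THE c. \<forall>x. P_a r s x = c \<and> P_b r s x = c)"

definition B_set :: "nat \<Rightarrow> (node \<Rightarrow> node) set" where
  "B_set r = {s \<in> M_set r. P_val r s = 0}"

definition R_at :: "nat \<Rightarrow> (node \<Rightarrow> node) \<Rightarrow> node \<Rightarrow> bit" where
  "R_at r s x = Par s (x @ [LA]) * Par s (x @ [LB])
     + (\<Sum>w\<in>words (r - 2). Par s (x @ [LA, LB] @ w) + Par s (x @ [LB, LB] @ w))"

definition Mt_set :: "nat \<Rightarrow> (node \<Rightarrow> node) set" where
  "Mt_set r = {s \<in> B_set r. \<forall>x1 x2. R_at r s x1 = R_at r s x2}"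

definition R_val :: "nat \<Rightarrow> (node \<Rightarrow> node) \<Rightarrow> bit" where
  "R_val r s = (THE c. \<forall>x. R_at r s x = c)"

definition Bt_set :: "nat \<Rightarrow> (node \<Rightarrow> node) set" where
  "Bt_set r = {s \<in> Mt_set r. R_val r s = 0}"

text \<open>A \<open>sum\<close> over an infinite set is 0 by convention; the index sets above are finite.\<close>

lemma finite_words: "finite (words n)"
proof -
  have "(UNIV :: letter set) = {LA, LB}"
    using letter.exhaust by auto
  then have "finite (UNIV :: letter set)"
    by (metis finite.emptyI finite.insertI)
  from finite_lists_length_eq[OF this, of n] show ?thesis
    by (simp add: words_def)
qed

lemma group_Aut_tree: "group Aut_tree"
proof (rule groupI)
  fix s assume s: "s \<in> carrier Aut_tree"
  then have b: "bij s" and r: "s [] = []" and e: "\<And>x y. tree_adj (s x) (s y) \<longleftrightarrow> tree_adj x y"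
    by (auto simp: Aut_tree_def tree_automorphism_def)
  have i: "s (inv_into UNIV s x) = x" for x
    using b by (simp add: bij_is_surj surj_f_inv_f)
  have "tree_adj (inv_into UNIV s x) (inv_into UNIV s y) \<longleftrightarrow> tree_adj x y" for x y
    using e[of "inv_into UNIV s x" "inv_into UNIV s y"] by (simp add: i)
  moreover have "inv_into UNIV s [] = []"
    using b r by (metis bij_inv_eq_iff)
  ultimately have "inv_into UNIV s \<in> carrier Aut_tree"
    using b by (simp add: Aut_tree_def tree_automorphism_def bij_imp_bij_inv)
  moreover have "inv_into UNIV s \<circ> s = id"
    using b by (simp add: bij_is_inj)
  ultimately show "\<exists>t\<in>carrier Aut_tree. t \<otimes>\<^bsub>Aut_tree\<^esub> s = \<one>\<^bsub>Aut_tree\<^esub>"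
    by (auto simp: Aut_tree_def)
qed (auto simp: Aut_tree_def tree_automorphism_def intro: bij_comp)

lemma group_Z2_add: "group Z2_add"
proof (rule groupI)
  fix x assume "x \<in> carrier Z2_add"
  show "\<exists>y\<in>carrier Z2_add. y \<otimes>\<^bsub>Z2_add\<^esub> x = \<one>\<^bsub>Z2_add\<^esub>"
    by (rule bexI[of _ "- x"]) (simp_all add: Z2_add_def)
qed (auto simp only: Z2_add_def monoid.simps partial_object.simps add.assoc add_0_left UNIV_I)

lemma tree_automorphism_child:
  assumes "tree_automorphism s"
  shows "\<exists>d. s (x @ [c]) = s x @ [d]"
proof (induction x arbitrary: c rule: rev_induct)
  case Nil
  have "tree_adj [] [c]"
    by (simp add: tree_adj_def)
  then have "tree_adj (s []) (s [c])" and "s [] = []"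
    using assms unfolding tree_automorphism_def by blast+
  then show ?case
    by (auto simp: tree_adj_def)
next
  case (snoc e x)
  have inj: "inj s"
    using assms by (simp add: tree_automorphism_def bij_is_inj)
  obtain f where f: "s (x @ [e]) = s x @ [f]"
    using snoc.IH by blast
  have "tree_adj (s (x @ [e])) (s ((x @ [e]) @ [c]))"
    using assms by (auto simp: tree_automorphism_def tree_adj_def)
  then consider (child) d where "s ((x @ [e]) @ [c]) = s (x @ [e]) @ [d]"
    | (parent) d where "s (x @ [e]) = s ((x @ [e]) @ [c]) @ [d]"
    by (auto simp: tree_adj_def)
  then show ?case
  proof cases
    case child
    then show ?thesis by blast
  next
    case parent
    with f have "s ((x @ [e]) @ [c]) = s x" by simp
    with inj have "(x @ [e]) @ [c] = x" by (blast dest: injD)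
    then show ?thesis by simp
  qed
qed

end

(* The parity cocycle Par (s o t) x = Par t x + Par s (t x) makes every sum of parities over a
   full level of a subtree additive in the same twisted sense, so P is additive.
   For R, expanding the product of parities at the two children of x leaves the cross terms
   Par t (xa) Par s (t (xb)) + Par t (xb) Par s (t (xa)).  In the sum part, t may swap the two
   children of xa (or xb), and correcting for that costs Par t (xa) times the full level sum of s
   below t (xa).  The condition P(s) = 0 says that this level sum is the parity of s at the
   sibling t (xb), so the corrections cancel the cross terms and R (s o t) x = R t x + R s (t x). *)

theory Submission
  imports Defs
begin

section \<open>Action of an automorphism on the children of a node\<close>

fun flip :: "letter \<Rightarrow> letter" where
  "flip LA = LB"
| "flip LB = LA"

lemma flip_flip [simp]: "flip (flip c) = c"
  by (cases c) simp_all

text \<open>The local permutation of \<open>t\<close> at \<open>x\<close>, acting on the labels of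
  its two children.\<close>

definition child_image :: "(node \<Rightarrow> node) \<Rightarrow> node \<Rightarrow> letter \<Rightarrow> letter" where
  "child_image t x c = (if Par t x = 0 then c else flip c)"

lemma child_image_flip: "child_image t x (flip c) = flip (child_image t x c)"
  by (simp add: child_image_def)

text \<open>\<open>Par\<close> records only where the child \<open>LA\<close> goes. Injectivity of
  \<open>t\<close> forces the child \<open>LB\<close> onto the other label, so the parity determines
  both images.\<close>

lemma automorphism_append_letter:
  assumes "tree_automorphism t"
  shows "t (x @ [c]) = t x @ [child_image t x c]"
proof -
  obtain d where d: "t (x @ [LA]) = t x @ [d]"
    using tree_automorphism_child[OF assms] by blast
  obtain e where e: "t (x @ [LB]) = t x @ [e]"
    using tree_automorphism_child[OF assms] by blast
  have "inj t"
    using assms by (simp add: tree_automorphism_def bij_is_inj)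
  then have "t (x @ [LA]) \<noteq> t (x @ [LB])"
    by (simp add: inj_eq)
  then have "d \<noteq> e"
    using d e by auto
  then show ?thesis
    using d e by (cases c; cases d; cases e) (simp_all add: child_image_def Par_def)
qed

lemma automorphism_comp:
  "tree_automorphism s \<Longrightarrow> tree_automorphism t \<Longrightarrow> tree_automorphism (s \<circ> t)"
  by (auto simp: tree_automorphism_def intro: bij_comp)

lemma Par_id [simp]: "Par id x = 0"
  by (simp add: Par_def)

lemma Par_comp:
  assumes "tree_automorphism s" "tree_automorphism t"
  shows "Par (s \<circ> t) x = Par t x + Par s (t x)"
proof -
  have "(s \<circ> t) (x @ [LA]) = s (t x) @ [child_image s (t x) (child_image t x LA)]"
    by (simp add: automorphism_append_letter assms)
  then have "Par (s \<circ> t) x = (if child_image s (t x) (child_image t x LA) = LA then 0 else 1)"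
    by (simp add: Par_def)
  also have "\<dots> = Par t x + Par s (t x)"
    by (cases "Par t x"; cases "Par s (t x)") (simp_all add: child_image_def)
  finally show ?thesis .
qed

section \<open>Sums over a level of a subtree\<close>

definition level_sum :: "(node \<Rightarrow> 'a::comm_monoid_add) \<Rightarrow> nat \<Rightarrow> node \<Rightarrow> 'a" where
  "level_sum f n y = (\<Sum>w\<in>words n. f (y @ w))"

lemma level_sum_0 [simp]: "level_sum f 0 y = f y"
  by (simp add: level_sum_def words_def)

lemma level_sum_Suc:
  "level_sum f (Suc n) y = level_sum f n (y @ [LA]) + level_sum f n (y @ [LB])"
proof -
  have "words (Suc n) = (#) LA ` words n \<union> (#) LB ` words n"
  proof (rule Set.set_eqI)
    fix w
    show "w \<in> words (Suc n) \<longleftrightarrow> w \<in> (#) LA ` words n \<union> (#) LB ` words n"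
    proof (cases w)
      case (Cons c v)
      then show ?thesis by (cases c) (auto simp: words_def)
    qed (auto simp: words_def)
  qed
  then have "level_sum f (Suc n) y
      = (\<Sum>w\<in>(#) LA ` words n. f (y @ w)) + (\<Sum>w\<in>(#) LB ` words n. f (y @ w))"
    unfolding level_sum_def by (simp only:, subst sum.union_disjoint) (auto simp: finite_words)
  then show ?thesis
    by (simp add: level_sum_def sum.reindex)
qed

text \<open>The letter is left free so that the sum can be split starting from the image of
  \<open>LA\<close>, whichever label that is.\<close>

lemma level_sum_Suc_flip:
  "level_sum f (Suc n) y = level_sum f n (y @ [c]) + level_sum f n (y @ [flip c])"
  by (cases c) (simp_all add: level_sum_Suc add.commute)

text \<open>\<open>t\<close> carries the level \<open>n\<close> below \<open>y\<close> bijectively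
  onto the level \<open>n\<close> below \<open>t y\<close>. The induction sees this one level at a
  time: the two subtrees are kept or exchanged, and the sum does not notice the order.\<close>

lemma level_sum_comp_automorphism:
  assumes "tree_automorphism t"
  shows "level_sum (\<lambda>x. f (t x)) n y = level_sum f n (t y)"
proof (induction n arbitrary: y)
  case (Suc n)
  have "level_sum (\<lambda>x. f (t x)) (Suc n) y
      = level_sum f n (t (y @ [LA])) + level_sum f n (t (y @ [flip LA]))"
    by (simp add: Suc level_sum_Suc)
  also have "\<dots> = level_sum f (Suc n) (t y)"
    by (simp only: automorphism_append_letter[OF assms] child_image_flip
        level_sum_Suc_flip[where c = "child_image t y LA"])
  finally show ?case .
qed simp

lemma level_sum_Par_comp:
  assumes "tree_automorphism s" "tree_automorphism t"
  shows "level_sum (Par (s \<circ> t)) n y = level_sum (Par t) n y + level_sum (Par s) n (t y)"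
proof -
  have "level_sum (Par (s \<circ> t)) n y
      = level_sum (Par t) n y + level_sum (\<lambda>x. Par s (t x)) n y"
    by (simp only: level_sum_def Par_comp[OF assms] sum.distrib)
  then show ?thesis
    by (simp add: level_sum_comp_automorphism[OF assms(2)])
qed

section \<open>The conditions on P\<close>

definition P_at :: "nat \<Rightarrow> (node \<Rightarrow> node) \<Rightarrow> node \<Rightarrow> letter \<Rightarrow> bit" where
  "P_at r s x c = Par s (x @ [flip c]) + level_sum (Par s) (r - 1) (x @ [c])"

text \<open>Where \<open>t\<close> exchanges the children of \<open>x\<close>, it exchanges the
  roles of \<open>P_a\<close> and \<open>P_b\<close>. Indexing both by a letter turns this into the
  relabelling \<open>child_image t x c\<close>.\<close>

lemma P_at_comp:
  assumes "tree_automorphism s" "tree_automorphism t"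
  shows "P_at r (s \<circ> t) x c = P_at r t x c + P_at r s (t x) (child_image t x c)"
  unfolding P_at_def Par_comp[OF assms] level_sum_Par_comp[OF assms]
    automorphism_append_letter[OF assms(2)] child_image_flip
  by (simp only: ac_simps)

lemma mem_B_set_iff:
  "s \<in> B_set r \<longleftrightarrow> tree_automorphism s \<and> (\<forall>x c. P_at r s x c = 0)"
proof -
  have 1: "P_a r s x = P_at r s x LA" "P_b r s x = P_at r s x LB" for x
    by (simp_all add: P_a_def P_b_def P_at_def level_sum_def)
  \<comment> \<open>Nodes exist, so a common value is unique and the description in
    \<open>P_val\<close> evaluates to it.\<close>
  have 2: "P_val r s = d" if "\<forall>x. P_a r s x = d \<and> P_b r s x = d" for d
    unfolding P_val_def by (rule the_equality) (use that in auto)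
  have "s \<in> B_set r
      \<longleftrightarrow> tree_automorphism s \<and> (\<forall>x. P_a r s x = 0 \<and> P_b r s x = 0)"
    unfolding B_set_def M_set_def using 2 by (auto simp: Aut_tree_def)
  also have "\<dots> \<longleftrightarrow> tree_automorphism s \<and> (\<forall>x c. P_at r s x c = 0)"
    unfolding 1 by (metis letter.exhaust)
  finally show ?thesis .
qed

section \<open>The composition law for R\<close>

lemma R_at_level_sum:
  "R_at r s x = Par s (x @ [c]) * Par s (x @ [flip c])
     + (level_sum (Par s) (r - 2) (x @ [c, LB]) + level_sum (Par s) (r - 2) (x @ [flip c, LB]))"
proof -
  have "R_at r s x = Par s (x @ [LA]) * Par s (x @ [LB])
     + (level_sum (Par s) (r - 2) (x @ [LA, LB]) + level_sum (Par s) (r - 2) (x @ [LB, LB]))"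
    by (simp only: R_at_def level_sum_def sum.distrib append_assoc)
  then show ?thesis
    by (cases c) (simp_all only: flip.simps ac_simps)
qed

text \<open>If the label \<open>LB\<close> turns into \<open>LA\<close>, the sum below
  \<open>LA\<close> replaces the one below \<open>LB\<close>. Modulo 2 these differ by their total,
  which is the sum one level deeper below \<open>y\<close>.\<close>

lemma level_sum_swap:
  fixes f :: "node \<Rightarrow> bit"
  shows "level_sum f n (y @ [child_image t x LB])
     = level_sum f n (y @ [LB]) + Par t x * level_sum f (Suc n) y"
  unfolding level_sum_Suc
  by (cases "Par t x"; cases "level_sum f n (y @ [LB])"; cases "level_sum f n (y @ [LA])")
     (simp_all add: child_image_def)

lemma R_at_comp:
  assumes r: "r \<ge> 2" and s: "s \<in> B_set r" and t: "tree_automorphism t"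
  shows "R_at r (s \<circ> t) x = R_at r t x + R_at r s (t x)"
proof -
  define d where "d = child_image t x LA"
  have s': "tree_automorphism s" and P: "P_at r s y c = 0" for y c
    using s by (auto simp: mem_B_set_iff)
  \<comment> \<open>The subtraction is not truncated here. Level \<open>r - 2\<close> below the
    grandchildren is thus level \<open>r - 1\<close> below the child, the level occurring in
    \<open>P_at\<close>.\<close>
  have r': "r - 1 = Suc (r - 2)"
    using r by simp
  have sib: "level_sum (Par s) (Suc (r - 2)) (y @ [c]) = Par s (y @ [flip c])" for y c
    using P[of y c] unfolding P_at_def r'
    by (cases "Par s (y @ [flip c])";
        cases "level_sum (Par s) (Suc (r - 2)) (y @ [c])") simp_all
  have child: "t (x @ [c]) = t x @ [child_image t x c]" for c
    by (rule automorphism_append_letter[OF t])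
  have grandchild: "level_sum (Par s) (r - 2) (t (x @ [c, LB]))
      = level_sum (Par s) (r - 2) (t x @ [child_image t x c, LB])
        + Par t (x @ [c]) * Par s (t x @ [flip (child_image t x c)])" for c
  proof -
    have "t (x @ [c, LB]) = (t x @ [child_image t x c]) @ [child_image t (x @ [c]) LB]"
      using automorphism_append_letter[OF t, of "x @ [c]" LB] child by simp
    then show ?thesis
      by (simp only: level_sum_swap sib) simp
  qed
  have flip_d: "child_image t x (flip LA) = flip d"
    by (simp only: d_def child_image_flip)
  \<comment> \<open>Here \<open>p\<close>, \<open>p'\<close> are the parities of \<open>t\<close> at
    the two children of \<open>x\<close> and \<open>q\<close>, \<open>q'\<close> those of
    \<open>s\<close> at their images; \<open>u\<close>, \<open>u'\<close> and \<open>v\<close>,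
    \<open>v'\<close> are the level sums of \<open>t\<close> and \<open>s\<close>. The terms
    \<open>p * q'\<close> and \<open>p' * q\<close> occur twice and vanish modulo 2.\<close>
  have ring: "(p + q) * (p' + q') + ((u + (v + p * q')) + (u' + (v' + p' * q)))
      = (p * p' + (u + u')) + (q * q' + (v + v'))" for p q p' q' u v u' v' :: bit
    by (cases p; cases q; cases p'; cases q'; cases u; cases v; cases u'; cases v') simp_all
  \<comment> \<open>R is symmetric in the two children, so at \<open>t x\<close> it may be read off
    starting from \<open>d\<close>, the image of \<open>LA\<close>. This lines up its terms with
    those at \<open>x\<close>.\<close>
  show ?thesis
    unfolding R_at_level_sum[of r "s \<circ> t" x LA] R_at_level_sum[of r t x LA]
      R_at_level_sum[of r s "t x" d] Par_comp[OF s' t] level_sum_Par_comp[OF s' t]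
      grandchild child flip_d d_def[symmetric] flip_flip
    by (rule ring)
qed

section \<open>Closure under products and inverses\<close>

lemma mem_Mt_set_iff:
  "s \<in> Mt_set r \<longleftrightarrow> s \<in> B_set r \<and> (\<exists>d. \<forall>x. R_at r s x = d)"
  unfolding Mt_set_def by auto

lemma R_at_eq_R_val: "s \<in> Mt_set r \<Longrightarrow> R_at r s x = R_val r s"
  unfolding R_val_def Mt_set_def by (rule the1I2) (auto intro: ex1I[of _ "R_at r s x"])

lemma id_mem_B_set: "id \<in> B_set r"
  by (simp add: mem_B_set_iff P_at_def level_sum_def tree_automorphism_def)

lemma comp_mem_B_set: "s \<in> B_set r \<Longrightarrow> t \<in> B_set r \<Longrightarrow> s \<circ> t \<in> B_set r"
  by (simp add: mem_B_set_iff automorphism_comp P_at_comp)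

lemma mem_B_set_if_right_inverse:
  assumes "s \<in> B_set r" "tree_automorphism t" "s \<circ> t = id"
  shows "t \<in> B_set r"
proof -
  have "P_at r t x c = 0" for x c
    using P_at_comp[of s t r x c] id_mem_B_set[of r] assms by (simp add: mem_B_set_iff)
  with assms(2) show ?thesis
    by (simp add: mem_B_set_iff)
qed

lemma R_at_id: "R_at r id x = 0"
  by (simp add: R_at_def)

text \<open>The composition law for \<open>s \<circ> t = id\<close> gives R of \<open>t\<close> as
  minus R of \<open>s\<close>, and signs disappear modulo 2. Constancy over all nodes passes from
  \<open>s\<close> to \<open>t\<close> in this way.\<close>

lemma R_at_right_inverse:
  assumes "r \<ge> 2" "s \<in> Mt_set r" "tree_automorphism t" "s \<circ> t = id"
  shows "R_at r t x = R_val r s"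
proof -
  have "0 = R_at r t x + R_at r s (t x)"
    using R_at_comp[of r s t x] assms by (simp add: R_at_id mem_Mt_set_iff)
  then show ?thesis
    using assms(2) by (cases "R_at r t x"; cases "R_val r s") (simp_all add: R_at_eq_R_val)
qed

lemma Mt_set_comp:
  assumes "r \<ge> 2" "s \<in> Mt_set r" "t \<in> Mt_set r"
  shows "s \<circ> t \<in> Mt_set r" "R_val r (s \<circ> t) = R_val r s + R_val r t"
proof -
  have s: "s \<in> B_set r" and t: "t \<in> B_set r"
    using assms(2,3) by (simp_all add: mem_Mt_set_iff)
  have R: "R_at r (s \<circ> t) x = R_val r s + R_val r t" for x
    using R_at_comp[OF assms(1) s, of t x] t
    by (simp only: mem_B_set_iff R_at_eq_R_val[OF assms(2)] R_at_eq_R_val[OF assms(3)] add.commute)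
  then show mem: "s \<circ> t \<in> Mt_set r"
    using comp_mem_B_set[OF s t] by (auto simp: mem_Mt_set_iff)
  show "R_val r (s \<circ> t) = R_val r s + R_val r t"
    using R R_at_eq_R_val[OF mem, of "[]"] by simp
qed

lemma Mt_set_right_inverse:
  assumes "r \<ge> 2" "s \<in> Mt_set r" "tree_automorphism t" "s \<circ> t = id"
  shows "t \<in> Mt_set r" "R_val r t = R_val r s"
proof -
  note R = R_at_right_inverse[OF assms]
  show mem: "t \<in> Mt_set r"
    using R mem_B_set_if_right_inverse[of s r t] assms by (auto simp: mem_Mt_set_iff)
  show "R_val r t = R_val r s"
    using R R_at_eq_R_val[OF mem, of "[]"] by simp
qed

lemma id_mem_Mt_set: "id \<in> Mt_set r"
  using id_mem_B_set by (auto simp: mem_Mt_set_iff R_at_id)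

lemma R_val_id: "R_val r id = 0"
  using R_at_eq_R_val[OF id_mem_Mt_set] R_at_id by metis

text \<open>Stating closure under inverses through \<open>s \<circ> t = id\<close> lets the
  composition laws apply directly, without computing with the inverse in the group.\<close>

lemma subgroup_Aut_treeI:
  assumes "H \<subseteq> carrier Aut_tree" "id \<in> H"
    and "\<And>s t. s \<in> H \<Longrightarrow> t \<in> H \<Longrightarrow> s \<circ> t \<in> H"
    and "\<And>s t. s \<in> H \<Longrightarrow> tree_automorphism t \<Longrightarrow> s \<circ> t = id \<Longrightarrow> t \<in> H"
  shows "subgroup H Aut_tree"
proof (rule group.subgroupI[OF group_Aut_tree])
  fix s assume s: "s \<in> H"
  then have "s \<in> carrier Aut_tree"
    using assms(1) by blast
  then have "inv\<^bsub>Aut_tree\<^esub> s \<in> carrier Aut_tree" "s \<otimes>\<^bsub>Aut_tree\<^esub> inv\<^bsub>Aut_tree\<^esub> s = \<one>\<^bsub>Aut_tree\<^esub>"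
    by (simp_all add: group.inv_closed group.r_inv group_Aut_tree)
  then show "inv\<^bsub>Aut_tree\<^esub> s \<in> H"
    using assms(4)[OF s] by (simp add: Aut_tree_def)
qed (use assms in \<open>auto simp: Aut_tree_def\<close>)

theorem theorem5p4:
  fixes r :: nat
  assumes "r \<ge> 3"
  shows "subgroup (Mt_set r) Aut_tree
       \<and> subgroup (Bt_set r) Aut_tree
       \<and> R_val r \<in> hom (Aut_tree\<lparr>carrier := Mt_set r\<rparr>) Z2_add
       \<and> kernel (Aut_tree\<lparr>carrier := Mt_set r\<rparr>) Z2_add (R_val r) = Bt_set r"
proof (intro conjI)
  have r: "r \<ge> 2"
    using assms by simp
  have Aut: "Mt_set r \<subseteq> carrier Aut_tree"
    by (auto simp: mem_Mt_set_iff mem_B_set_iff Aut_tree_def)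
  show "subgroup (Mt_set r) Aut_tree"
    using Aut id_mem_Mt_set Mt_set_comp[OF r] Mt_set_right_inverse[OF r]
    by (intro subgroup_Aut_treeI) auto
  \<comment> \<open>The value 0 survives because R is additive on products and unchanged by
    inversion.\<close>
  show "subgroup (Bt_set r) Aut_tree"
    using Aut id_mem_Mt_set R_val_id Mt_set_comp[OF r] Mt_set_right_inverse[OF r]
    unfolding Bt_set_def by (intro subgroup_Aut_treeI) auto
  show "R_val r \<in> hom (Aut_tree\<lparr>carrier := Mt_set r\<rparr>) Z2_add"
    by (auto simp: hom_def Aut_tree_def Z2_add_def Mt_set_comp[OF r])
  show "kernel (Aut_tree\<lparr>carrier := Mt_set r\<rparr>) Z2_add (R_val r) = Bt_set r"
    by (simp add: kernel_def Bt_set_def Z2_add_def)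
qed

end
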